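(* There exists a quantum correlation $p\in Q(5)$ that is not contained in $L(5)$. In other words, the complete graph $K_5$ admits nonlocal symmetry.
   Context: Write $[n]=\{1,\dots,n\}$. In the $K_n$-automorphism game, Alice and Bob receive inputs $i,j\in[n]$ and answer $l,k\in[n]$ respectively (without communicating); they win iff $\delta_{ij}=\delta_{lk}$. A correlation is a function $p:[n]^4\to[0,1]$, written $p(l,k|i,j)$, with $\sum_{l,k}p(l,k|i,j)=1$ for all $i,j$. It is winning if $p(l,k|i,j)=0$ whenever $\delta_{ij}\neq\delta_{lk}$. For $\pi\in S_n$ let $p_\pi(l,k|i,j)=1$ if $l=\pi(i)$ and $k=\pi(j)$, and $0$ otherwise. $L(n)=\operatorname{conv}\{p_\pi:\pi\in S_n\}$ is the set of winning classical correlations for the $K_n$-automorphism game. $Q(n)$ is the set of winning quantum correlations for the $K_n$-automorphism game: winning correlations of the form $p(l,k|i,j)=\psi^*M_{il}N_{jk}\psi$, where $\psi$ is a unit vector in a Hilbert space $\mathcal H$, and $M_{il},N_{jk}\in B(\mathcal H)$ are positive semidefinite operators with $\sum_l M_{il}=\mathbf 1=\sum_k N_{jk}$ for all $i,j$ and $M_{il}N_{jk}=N_{jk}M_{il}$ for all $i,j,l,k$. It is known that $p\in Q(n)$ if and only if there are a unital $C^*$-algebra $\mathcal A$ with a tracial state $\tau$ and a quantum permutation matrix $U=(u_{ij})\in M_n(\mathcal A)$ (i.e. $u_{ij}=u_{ij}^*=u_{ij}^2$ and $\sum_k u_{ik}=\sum_k u_{ki}=\mathbf 1$ for all $i$) such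 that $p(l,k|i,j)=\tau(u_{il}u_{jk})$ for all $i,j,l,k\in[n]$. The graph $K_n$ admits nonlocal symmetry if $Q(n)\neq L(n)$. *)

theory Defs
  imports
    "HOL-Analysis.Analysis"
    "HOL-Algebra.Module"
    "HOL-Algebra.Algebraic_Closure_Type"
begin

unbundle no fps_syntax

section \<open>Complex Hilbert spaces and bounded operators\<close>

text \<open>
  The carrier-based modules of HOL-Algebra over the field of complex numbers are equipped with an
  inner product. (The record fields \<open>mult\<close> and \<open>one\<close> that modules inherit from rings are unused.)
  The inner product is linear in its second argument, so that \<open>\<psi>\<^sup>* T \<phi>\<close> is \<open>hinner H \<psi> (T \<phi>)\<close>.
\<close>

record 'h cinner_space = "(complex, 'h) module" +
  hinner :: "'h \<Rightarrow> 'h \<Rightarrow> complex"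

definition hnorm :: "'h cinner_space \<Rightarrow> 'h \<Rightarrow> real" where
  "hnorm H x = sqrt (Re (hinner H x x))"

locale complex_hilbert_space =
  Module.module "ring_of_type_algebra :: complex ring" H
  for H :: "'h cinner_space" +
  assumes hinner_commute:
      "\<lbrakk>x \<in> carrier H; y \<in> carrier H\<rbrakk> \<Longrightarrow> hinner H y x = cnj (hinner H x y)"
    and hinner_add_right:
      "\<lbrakk>x \<in> carrier H; y \<in> carrier H; z \<in> carrier H\<rbrakk> \<Longrightarrow>
        hinner H x (y \<oplus>\<^bsub>H\<^esub> z) = hinner H x y + hinner H x z"
    and hinner_smult_right:
      "\<lbrakk>x \<in> carrier H; y \<in> carrier H\<rbrakk> \<Longrightarrow> hinner H x (c \<odot>\<^bsub>H\<^esub> y) = c * hinner H x y"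
    and hinner_pos:
      "\<lbrakk>x \<in> carrier H; x \<noteq> \<zero>\<^bsub>H\<^esub>\<rbrakk> \<Longrightarrow> 0 < Re (hinner H x x)"
    and complete:
      "\<lbrakk>\<And>n :: nat. s n \<in> carrier H;
        \<And>e. 0 < e \<Longrightarrow> \<exists>N. \<forall>m\<ge>N. \<forall>n\<ge>N. hnorm H (s m \<ominus>\<^bsub>H\<^esub> s n) < e\<rbrakk> \<Longrightarrow>
        \<exists>x\<in>carrier H. (\<lambda>n. hnorm H (s n \<ominus>\<^bsub>H\<^esub> x)) \<longlonglongrightarrow> 0"

definition bounded_operator :: "'h cinner_space \<Rightarrow> ('h \<Rightarrow> 'h) \<Rightarrow> bool" where
  "bounded_operator H T \<longleftrightarrow>
     (\<forall>x\<in>carrier H. T x \<in> carrier H) \<and>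
     (\<forall>x\<in>carrier H. \<forall>y\<in>carrier H. T (x \<oplus>\<^bsub>H\<^esub> y) = T x \<oplus>\<^bsub>H\<^esub> T y) \<and>
     (\<forall>c. \<forall>x\<in>carrier H. T (c \<odot>\<^bsub>H\<^esub> x) = c \<odot>\<^bsub>H\<^esub> T x) \<and>
     (\<exists>C. \<forall>x\<in>carrier H. hnorm H (T x) \<le> C * hnorm H x)"

text \<open>Self-adjointness is implied, since \<open>H\<close> is complex.\<close>

definition positive_operator :: "'h cinner_space \<Rightarrow> ('h \<Rightarrow> 'h) \<Rightarrow> bool" where
  "positive_operator H T \<longleftrightarrow>
     bounded_operator H T \<and> (\<forall>x\<in>carrier H. hinner H x (T x) \<in> \<real>\<^sub>\<ge>\<^sub>0)"

section \<open>Correlations for the automorphism game of a complete graph\<close>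

text \<open>
  The set \<open>[n]\<close> is rendered as a finite type \<open>'n\<close> with \<open>n\<close> elements. The number \<open>p(l,k|i,j)\<close>
  (answers \<open>l\<close>, \<open>k\<close> to the inputs \<open>i\<close>, \<open>j\<close>) is \<open>p $ (l, k, i, j)\<close>.
\<close>

type_synonym 'n correlation = "real ^ ('n \<times> 'n \<times> 'n \<times> 'n)"

definition is_correlation :: "'n::finite correlation \<Rightarrow> bool" where
  "is_correlation p \<longleftrightarrow>
     (\<forall>l k i j. 0 \<le> p $ (l, k, i, j) \<and> p $ (l, k, i, j) \<le> 1) \<and>
     (\<forall>i j. (\<Sum>l\<in>UNIV. \<Sum>k\<in>UNIV. p $ (l, k, i, j)) = 1)"

definition is_winning :: "'n::finite correlation \<Rightarrow> bool" where
  "is_winning p \<longleftrightarrow> (\<forall>l k i j. (i = j) \<noteq> (l = k) \<longrightarrow> p $ (l, k, i, j) = 0)"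

definition perm_correlation :: "('n::finite \<Rightarrow> 'n) \<Rightarrow> 'n correlation" where
  "perm_correlation \<pi> = (\<chi> a. case a of (l, k, i, j) \<Rightarrow> if l = \<pi> i \<and> k = \<pi> j then 1 else 0)"

definition L_set :: "'n::finite correlation set" where
  "L_set = convex hull {perm_correlation \<pi> | \<pi>. bij \<pi>}"

definition quantum_strategy ::
  "'h cinner_space \<Rightarrow> 'h \<Rightarrow> ('n::finite \<Rightarrow> 'n \<Rightarrow> 'h \<Rightarrow> 'h) \<Rightarrow> ('n \<Rightarrow> 'n \<Rightarrow> 'h \<Rightarrow> 'h) \<Rightarrow> bool" where
  "quantum_strategy H \<psi> M N \<longleftrightarrow>
     complex_hilbert_space H \<and>
     \<psi> \<in> carrier H \<and> hnorm H \<psi> = 1 \<and>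
     (\<forall>i l. positive_operator H (M i l)) \<and>
     (\<forall>j k. positive_operator H (N j k)) \<and>
     (\<forall>i. \<forall>x\<in>carrier H. (\<Oplus>\<^bsub>H\<^esub>l\<in>UNIV. M i l x) = x) \<and>
     (\<forall>j. \<forall>x\<in>carrier H. (\<Oplus>\<^bsub>H\<^esub>k\<in>UNIV. N j k x) = x) \<and>
     (\<forall>i l j k. \<forall>x\<in>carrier H. M i l (N j k x) = N j k (M i l x))"

text \<open>
  HOL cannot quantify existentially over types, so the carrier of the Hilbert space is taken to be a
  subset of \<open>nat \<Rightarrow> complex\<close>, with arbitrary vector space operations and inner product on it. This is
  no restriction. In any Hilbert space, the closed linear span of the vectors \<open>w \<psi>\<close>, for \<open>w\<close> a finite
  product of operators \<open>M i l\<close> and \<open>N j k\<close>, contains \<open>\<psi>\<close> and is invariant under these (self-adjoint)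
  operators, and restricting to it gives a strategy with the same correlation. This subspace is
  separable, so it has at most as many elements as \<open>nat \<Rightarrow> complex\<close> and its structure can be
  transported along an injection.
\<close>

definition Q_set :: "'n::finite correlation set" where
  "Q_set = {p. is_correlation p \<and> is_winning p \<and>
     (\<exists>(H :: (nat \<Rightarrow> complex) cinner_space) \<psi> M N.
        quantum_strategy H \<psi> M N \<and>
        (\<forall>i j l k. complex_of_real (p $ (l, k, i, j)) = hinner H \<psi> (M i l (N j k \<psi>))))}"

definition complete_graph_admits_nonlocal_symmetry :: "'n::finite itself \<Rightarrow> bool" where
  "complete_graph_admits_nonlocal_symmetry _ \<longleftrightarrow> (Q_set :: 'n correlation set) \<noteq> L_set"

end

theory Submission
  imports Defs
begin

text \<open>
  For \<open>{0, 1}\<close>-valued random variables \<open>a, b, c\<close> the expectation of \<open>(a - b) * (a - c)\<close> is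
  nonnegative. Applied to entries \<open>a, b, c\<close> of a random permutation matrix, this is a linear
  inequality for \<open>L(n)\<close>. For projections onto lines spanned by unit vectors \<open>a, b, c\<close>, the
  normalised trace turns it into \<open>\<langle>a,b\<rangle>\<^sup>2 + \<langle>a,c\<rangle>\<^sup>2 \<le> 1 + \<langle>b,c\<rangle>\<^sup>2\<close>, which fails for
  instance when \<open>a\<close> bisects an acute angle between \<open>b\<close> and \<open>c\<close>. So it suffices to arrange lines
  of \<open>\<real>\<^sup>3\<close> in a \<open>5 \<times> 5\<close> array, each row and each column consisting of an orthogonal basis and
  two zeros, such that three of the lines violate the inequality. A quantum strategy for the
  resulting correlation lets the matrices act on \<open>M\<^sub>3(\<complex>)\<close>, with the Hilbert-Schmidt inner
  product, by left and right multiplication.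
\<close>

\<comment> \<open>In \<open>Defs\<close> the name \<open>fps_syntax\<close> denotes the bundle for Laurent series, which does not cover this.\<close>
no_notation fps_nth (infixl "$" 75)

section \<open>Complex matrices as a Hilbert space\<close>

definition hermitian :: "complex ^ 'd ^ 'd \<Rightarrow> bool" where
  "hermitian A \<longleftrightarrow> (\<forall>a b. cnj (A $ a $ b) = A $ b $ a)"

lemma hermitian_cnj: "hermitian A \<Longrightarrow> cnj (A $ a $ b) = A $ b $ a"
  by (simp add: hermitian_def)

definition hs_inner :: "complex ^ 'd ^ 'd \<Rightarrow> complex ^ 'd ^ 'd \<Rightarrow> complex" where
  "hs_inner x y = (\<Sum>a\<in>UNIV. \<Sum>b\<in>UNIV. cnj (x $ a $ b) * y $ a $ b)"

lemma hs_inner_commute: "hs_inner y x = cnj (hs_inner x y)"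
  by (simp add: hs_inner_def mult.commute)

lemma hs_inner_add_right: "hs_inner x (y + z) = hs_inner x y + hs_inner x z"
  by (simp add: hs_inner_def sum.distrib algebra_simps)

lemma map_matrix_mult_left: "map_matrix ((*) c) A ** B = map_matrix ((*) c) (A ** B)"
  for c :: "'a::comm_semiring_1"
  by (simp add: matrix_matrix_mult_def vec_eq_iff sum_distrib_left mult_ac)

lemma map_matrix_mult_right: "A ** map_matrix ((*) c) B = map_matrix ((*) c) (A ** B)"
  for c :: "'a::comm_semiring_1"
  by (simp add: matrix_matrix_mult_def vec_eq_iff sum_distrib_left mult_ac)

lemma hs_inner_scale_right: "hs_inner x (map_matrix ((*) c) y) = c * hs_inner x y"
  by (simp add: hs_inner_def map_matrix_def sum_distrib_left mult_ac)

lemma hs_inner_scale_left: "hs_inner (map_matrix ((*) c) x) y = cnj c * hs_inner x y"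
  by (simp add: hs_inner_def map_matrix_def sum_distrib_left mult_ac)

text \<open>This links the inner product to the Euclidean norm of the type of matrices, from which
  completeness and boundedness are inherited.\<close>

lemma hs_inner_self: "hs_inner x x = of_real ((norm x)\<^sup>2)"
proof -
  have "(norm x)\<^sup>2 = (\<Sum>a\<in>UNIV. \<Sum>b\<in>UNIV. (cmod (x $ a $ b))\<^sup>2)"
    by (simp add: norm_vec_def L2_set_def sum_nonneg)
  then show ?thesis
    by (simp add: hs_inner_def complex_norm_square mult.commute del: of_real_power)
qed

text \<open>The adjoint of left multiplication by \<open>A\<close> is left multiplication by the
  conjugate transpose, here \<open>A\<close> itself. Only the order of summation has to be
  rearranged.\<close>

lemma hs_inner_mult_left:
  assumes "hermitian A"
  shows "hs_inner x (A ** y) = hs_inner (A ** x) y"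
proof -
  have "hs_inner x (A ** y) =
      (\<Sum>a\<in>UNIV. \<Sum>b\<in>UNIV. \<Sum>k\<in>UNIV. cnj (x $ a $ b) * (A $ a $ k * y $ k $ b))"
    by (simp add: hs_inner_def matrix_matrix_mult_def sum_distrib_left)
  also have "\<dots> = (\<Sum>b\<in>UNIV. \<Sum>a\<in>UNIV. \<Sum>k\<in>UNIV. cnj (x $ a $ b) * (A $ a $ k * y $ k $ b))"
    by (rule sum.swap)
  also have "\<dots> = (\<Sum>b\<in>UNIV. \<Sum>k\<in>UNIV. \<Sum>a\<in>UNIV. cnj (x $ a $ b) * (A $ a $ k * y $ k $ b))"
    by (rule sum.cong[OF refl], rule sum.swap)
  also have "\<dots> = (\<Sum>k\<in>UNIV. \<Sum>b\<in>UNIV. \<Sum>a\<in>UNIV. cnj (x $ a $ b) * (A $ a $ k * y $ k $ b))"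
    by (rule sum.swap)
  also have "\<dots> = (\<Sum>k\<in>UNIV. \<Sum>b\<in>UNIV. \<Sum>a\<in>UNIV. cnj (A $ k $ a * x $ a $ b) * y $ k $ b)"
    using assms by (intro sum.cong refl) (simp add: hermitian_cnj mult_ac)
  also have "\<dots> = hs_inner (A ** x) y"
    by (simp add: hs_inner_def matrix_matrix_mult_def sum_distrib_right)
  finally show ?thesis .
qed

lemma hs_inner_mult_right:
  assumes "hermitian A"
  shows "hs_inner x (y ** A) = hs_inner (x ** A) y"
proof -
  have "hs_inner x (y ** A) =
      (\<Sum>a\<in>UNIV. \<Sum>b\<in>UNIV. \<Sum>k\<in>UNIV. cnj (x $ a $ b) * (y $ a $ k * A $ k $ b))"
    by (simp add: hs_inner_def matrix_matrix_mult_def sum_distrib_left)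
  also have "\<dots> = (\<Sum>a\<in>UNIV. \<Sum>k\<in>UNIV. \<Sum>b\<in>UNIV. cnj (x $ a $ b) * (y $ a $ k * A $ k $ b))"
    by (rule sum.cong[OF refl], rule sum.swap)
  also have "\<dots> = (\<Sum>a\<in>UNIV. \<Sum>k\<in>UNIV. \<Sum>b\<in>UNIV. cnj (x $ a $ b * A $ b $ k) * y $ a $ k)"
    using assms by (intro sum.cong refl) (simp add: hermitian_cnj mult_ac)
  also have "\<dots> = hs_inner (x ** A) y"
    by (simp add: hs_inner_def matrix_matrix_mult_def sum_distrib_right)
  finally show ?thesis .
qed

lemma hs_inner_eq_trace:
  assumes "hermitian A"
  shows "hs_inner A B = trace (A ** B)"
proof -
  have "hs_inner A B = (\<Sum>a\<in>UNIV. \<Sum>b\<in>UNIV. A $ b $ a * B $ a $ b)"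
    using assms by (simp add: hs_inner_def hermitian_cnj)
  also have "\<dots> = (\<Sum>b\<in>UNIV. \<Sum>a\<in>UNIV. A $ b $ a * B $ a $ b)"
    by (rule sum.swap)
  also have "\<dots> = trace (A ** B)"
    by (simp add: trace_def matrix_matrix_mult_def)
  finally show ?thesis .
qed

text \<open>\<open>Q_set\<close> asks for a carrier inside \<open>nat \<Rightarrow> complex\<close>,
  so the structure on matrices is transported along \<open>\<phi>\<close>. Complex scalars act
  entrywise through \<open>map_matrix\<close>, since \<open>*s\<close> on nested vectors would take
  a vector as scalar.\<close>

definition hs_space :: "(complex ^ 'd ^ 'd \<Rightarrow> 'h) \<Rightarrow> 'h cinner_space" where
  "hs_space \<phi> =
     \<lparr>carrier = range \<phi>, mult = undefined, one = undefined, zero = \<phi> 0,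
      add = (\<lambda>x y. \<phi> (inv_into UNIV \<phi> x + inv_into UNIV \<phi> y)),
      smult = (\<lambda>c x. \<phi> (map_matrix ((*) c) (inv_into UNIV \<phi> x))),
      hinner = (\<lambda>x y. hs_inner (inv_into UNIV \<phi> x) (inv_into UNIV \<phi> y))\<rparr>"

context
  fixes \<phi> :: "complex ^ 'd ^ 'd \<Rightarrow> 'h"
  assumes inj: "inj \<phi>"
begin

lemma hs_space_simps [simp]:
  "carrier (hs_space \<phi>) = range \<phi>"
  "\<zero>\<^bsub>hs_space \<phi>\<^esub> = \<phi> 0"
  "\<phi> x \<oplus>\<^bsub>hs_space \<phi>\<^esub> \<phi> y = \<phi> (x + y)"
  "c \<odot>\<^bsub>hs_space \<phi>\<^esub> \<phi> x = \<phi> (map_matrix ((*) c) x)"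
  "hinner (hs_space \<phi>) (\<phi> x) (\<phi> y) = hs_inner x y"
  using inj by (simp_all add: hs_space_def)

lemma hnorm_hs_space [simp]: "hnorm (hs_space \<phi>) (\<phi> x) = norm x"
  by (simp add: hnorm_def hs_inner_self)

lemma abelian_group_hs_space: "abelian_group (hs_space \<phi>)"
proof (rule abelian_groupI)
  show "\<exists>y\<in>carrier (hs_space \<phi>). y \<oplus>\<^bsub>hs_space \<phi>\<^esub> x = \<zero>\<^bsub>hs_space \<phi>\<^esub>"
    if "x \<in> carrier (hs_space \<phi>)" for x
  proof -
    obtain u where "x = \<phi> u" using \<open>x \<in> carrier (hs_space \<phi>)\<close> by auto
    then show ?thesis by (intro bexI[of _ "\<phi> (- u)"]) simp_all
  qed
qed (auto simp: algebra_simps)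

lemma hs_space_minus [simp]: "\<phi> x \<ominus>\<^bsub>hs_space \<phi>\<^esub> \<phi> y = \<phi> (x - y)"
proof -
  interpret abelian_group "hs_space \<phi>" by (rule abelian_group_hs_space)
  have "\<ominus>\<^bsub>hs_space \<phi>\<^esub> \<phi> y = \<phi> (- y)"
    by (rule minus_equality) simp_all
  then show ?thesis by (simp add: a_minus_def)
qed

lemma finsum_hs_space:
  assumes "finite A"
  shows "(\<Oplus>\<^bsub>hs_space \<phi>\<^esub>l\<in>A. \<phi> (f l)) = \<phi> (\<Sum>l\<in>A. f l)"
proof -
  interpret abelian_group "hs_space \<phi>" by (rule abelian_group_hs_space)
  show ?thesis using assms by (induction A) simp_all
qed

lemma complex_hilbert_space_hs_space: "complex_hilbert_space (hs_space \<phi>)"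
proof -
  let ?H = "hs_space \<phi>"
  have "Module.module (ring_of_type_algebra :: complex ring) ?H"
    by (rule moduleI[OF cring_from_type_algebra abelian_group_hs_space])
      (auto simp: ring_of_type_algebra_def map_matrix_def vec_eq_iff algebra_simps
        intro!: arg_cong[of _ _ \<phi>])
  moreover have "complex_hilbert_space_axioms ?H"
  proof
    show "hinner ?H y x = cnj (hinner ?H x y)" if "x \<in> carrier ?H" "y \<in> carrier ?H" for x y
      using that by (auto intro: hs_inner_commute)
    show "hinner ?H x (y \<oplus>\<^bsub>?H\<^esub> z) = hinner ?H x y + hinner ?H x z"
      if "x \<in> carrier ?H" "y \<in> carrier ?H" "z \<in> carrier ?H" for x y z
      using that by (auto intro: hs_inner_add_right)
    show "hinner ?H x (c \<odot>\<^bsub>?H\<^esub> y) = c * hinner ?H x y"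
      if "x \<in> carrier ?H" "y \<in> carrier ?H" for x y c
      using that by (auto intro: hs_inner_scale_right)
    show "0 < Re (hinner ?H x x)" if "x \<in> carrier ?H" "x \<noteq> \<zero>\<^bsub>?H\<^esub>" for x
      using that by (auto simp: hs_inner_self)
    show "\<exists>x\<in>carrier ?H. (\<lambda>n. hnorm ?H (s n \<ominus>\<^bsub>?H\<^esub> x)) \<longlonglongrightarrow> 0"
      if s: "\<And>n. s n \<in> carrier ?H"
        and cauchy: "\<And>e. 0 < e \<Longrightarrow> \<exists>N. \<forall>m\<ge>N. \<forall>n\<ge>N. hnorm ?H (s m \<ominus>\<^bsub>?H\<^esub> s n) < e"
      for s :: "nat \<Rightarrow> 'h"
    proof -
      define t where "t n = inv_into UNIV \<phi> (s n)" for n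
      have st: "s n = \<phi> (t n)" for n
        using s[of n] by (simp add: t_def f_inv_into_f)
      \<comment> \<open>The transported norm is the matrix norm, so the limit exists in a complete
        type.\<close>
      have "Cauchy t"
        using cauchy by (simp add: st Cauchy_def dist_norm)
      then obtain l where "t \<longlonglongrightarrow> l"
        using Cauchy_convergent convergentD by blast
      then have "(\<lambda>n. norm (t n - l)) \<longlonglongrightarrow> 0"
        by (metis LIM_zero tendsto_norm_zero)
      then show ?thesis
        by (intro bexI[of _ "\<phi> l"]) (simp_all add: st)
    qed
  qed
  ultimately show ?thesis
    by (simp add: complex_hilbert_space_def)
qed

text \<open>For a self-adjoint idempotent, \<open>hs_inner x (T x)\<close> equals
  \<open>hs_inner (T x) (T x)\<close>, which is a squared norm. Boundedness is automatic in finite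
  dimension once complex homogeneity is specialised to real scalars.\<close>

lemma positive_operator_hs_space:
  assumes add: "\<And>x y. T (x + y) = T x + T y"
    and scale: "\<And>c x. T (map_matrix ((*) c) x) = map_matrix ((*) c) (T x)"
    and sa: "\<And>x y. hs_inner x (T y) = hs_inner (T x) y"
    and idem: "\<And>x. T (T x) = T x"
  shows "positive_operator (hs_space \<phi>) (\<lambda>v. \<phi> (T (inv_into UNIV \<phi> v)))"
proof -
  have "linear T"
  proof
    show "T (r *\<^sub>R x) = r *\<^sub>R T x" for r x
    proof -
      have "r *\<^sub>R x = map_matrix ((*) (complex_of_real r)) x" for x :: "complex ^ 'd ^ 'd"
        by (simp add: vec_eq_iff) (simp add: scaleR_conv_of_real)
      then show ?thesis by (simp add: scale)
    qed
  qed (rule add)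
  then obtain C where "norm (T x) \<le> C * norm x" for x
    using linear_bounded by blast
  moreover have "hs_inner x (T x) \<in> \<real>\<^sub>\<ge>\<^sub>0" for x
  proof -
    have "hs_inner x (T x) = hs_inner (T x) (T x)"
      by (metis sa idem)
    then show ?thesis by (simp add: hs_inner_self del: of_real_power)
  qed
  ultimately show ?thesis
    using inj by (auto simp: positive_operator_def bounded_operator_def add scale)
qed

end

section \<open>Finite sums and traces of matrices; matrices as sequences\<close>

lemma matrix_add_rdistrib: "(A + B) ** C = A ** C + B ** C"
  by (vector matrix_matrix_mult_def sum.distrib distrib_right)

lemma matrix_sum_ldistrib: "A ** (\<Sum>i\<in>I. f i) = (\<Sum>i\<in>I. A ** f i)"
  by (induction I rule: infinite_finite_induct) (simp_all add: matrix_add_ldistrib)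

lemma matrix_sum_rdistrib: "(\<Sum>i\<in>I. f i) ** A = (\<Sum>i\<in>I. f i ** A)"
  by (induction I rule: infinite_finite_induct) (simp_all add: matrix_add_rdistrib)

lemma trace_sum: "trace (\<Sum>i\<in>I. f i) = (\<Sum>i\<in>I. trace (f i))"
  for f :: "_ \<Rightarrow> 'a::comm_semiring_1 ^ 'n ^ 'n"
  by (induction I rule: infinite_finite_induct) (simp_all add: trace_add trace_0[unfolded mat_0])

lemma ex_inj_matrix_seq: "\<exists>\<phi> :: complex ^ 'd ^ 'd \<Rightarrow> nat \<Rightarrow> complex. inj \<phi>"
proof -
  obtain e :: "'d \<times> 'd \<Rightarrow> nat" where e: "inj e"
    using finite_imp_inj_to_nat_seg[of "UNIV :: ('d \<times> 'd) set"] by auto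
  \<comment> \<open>A matrix is listed entry by entry. Outside the range of \<open>e\<close> some
    unspecified entry is repeated, which does not harm injectivity.\<close>
  define \<phi> :: "complex ^ 'd ^ 'd \<Rightarrow> nat \<Rightarrow> complex"
    where "\<phi> x n = x $ fst (inv_into UNIV e n) $ snd (inv_into UNIV e n)" for x n
  have "x $ a $ b = \<phi> x (e (a, b))" for x a b
    using e by (simp add: \<phi>_def)
  then have "inj \<phi>"
    by (intro injI) (simp add: vec_eq_iff)
  then show ?thesis by blast
qed

section \<open>Correlations from quantum permutation matrices\<close>

text \<open>These are the quantum permutation matrices over the algebra of complex \<open>d\<close>
  by \<open>d\<close> matrices; its tracial state is the trace divided by \<open>d\<close>.\<close>

definition magic_unitary :: "('n::finite \<Rightarrow> 'n \<Rightarrow> complex ^ 'd ^ 'd) \<Rightarrow> bool" where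
  "magic_unitary u \<longleftrightarrow>
     (\<forall>i l. hermitian (u i l) \<and> u i l ** u i l = u i l) \<and>
     (\<forall>i. (\<Sum>l\<in>UNIV. u i l) = mat 1) \<and> (\<forall>l. (\<Sum>i\<in>UNIV. u i l) = mat 1)"

definition trace_correlation ::
  "('n::finite \<Rightarrow> 'n \<Rightarrow> complex ^ 'd ^ 'd) \<Rightarrow> 'n correlation" where
  "trace_correlation u =
     (\<chi> a. case a of (l, k, i, j) \<Rightarrow> Re (trace (u i l ** u j k)) / real CARD('d))"

text \<open>Doubling both projections and moving one copy of each across the inner product gives a
  squared norm. So the trace is real and nonnegative although \<open>P ** Q\<close> need not be
  hermitian.\<close>

lemma trace_mult_projections:
  assumes "hermitian P" "P ** P = P" "hermitian Q" "Q ** Q = Q"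
  shows "trace (P ** Q) = of_real ((norm (P ** Q))\<^sup>2)"
proof -
  have "trace (P ** Q) = hs_inner P (Q ** Q)"
    using assms by (simp add: hs_inner_eq_trace)
  also have "\<dots> = hs_inner (P ** P) (Q ** Q)"
    by (simp add: assms)
  also have "\<dots> = hs_inner (P ** P ** Q) Q"
    using assms(3) by (rule hs_inner_mult_right)
  also have "\<dots> = hs_inner (P ** (P ** Q)) Q"
    by (simp add: matrix_mul_assoc)
  also have "\<dots> = hs_inner (P ** Q) (P ** Q)"
    using assms(1) by (rule hs_inner_mult_left[symmetric])
  finally show ?thesis by (simp add: hs_inner_self)
qed

context
  fixes u :: "'n::finite \<Rightarrow> 'n \<Rightarrow> complex ^ 'd ^ 'd"
  assumes magic: "magic_unitary u"
begin

lemma magic_hermitian: "hermitian (u i l)"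
  and magic_idem [simp]: "u i l ** u i l = u i l"
  and magic_row: "(\<Sum>l\<in>UNIV. u i l) = mat 1"
  using magic by (simp_all add: magic_unitary_def)

lemma trace_magic: "trace (u i l ** u j k) = of_real ((norm (u i l ** u j k))\<^sup>2)"
  by (intro trace_mult_projections magic_hermitian magic_idem)

text \<open>
  The entries of a row sum to \<open>1\<close>, so \<open>\<tau>(P\<^sub>l) = \<Sum>\<^sub>k \<tau>(P\<^sub>l P\<^sub>k)\<close>, and the nonnegative
  terms with \<open>k \<noteq> l\<close> vanish.
\<close>
lemma trace_magic_row:
  assumes "l \<noteq> k"
  shows "trace (u i l ** u i k) = 0"
proof -
  have "of_real (\<Sum>k\<in>UNIV. (norm (u i l ** u i k))\<^sup>2) = (\<Sum>k\<in>UNIV. trace (u i l ** u i k))"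
    by (simp add: trace_magic)
  also have "\<dots> = trace (u i l)"
    by (simp flip: trace_sum matrix_sum_ldistrib add: magic_row)
  also have "\<dots> = of_real ((norm (u i l ** u i l))\<^sup>2)"
    by (metis trace_magic magic_idem)
  finally have "(\<Sum>k\<in>UNIV. (norm (u i l ** u i k))\<^sup>2) = (norm (u i l ** u i l))\<^sup>2"
    using of_real_eq_iff by blast
  then have "(\<Sum>k\<in>UNIV - {l}. (norm (u i l ** u i k))\<^sup>2) = 0"
    by (simp add: sum_diff1)
  then have "(norm (u i l ** u i k))\<^sup>2 = 0"
    using assms by (subst (asm) sum_nonneg_eq_0_iff) auto
  then show ?thesis by (simp add: trace_def)
qed

end

lemma magic_unitary_transpose: "magic_unitary u \<Longrightarrow> magic_unitary (\<lambda>i l. u l i)"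
  by (auto simp: magic_unitary_def)

lemma trace_correlation_in_Q_set:
  fixes u :: "'n::finite \<Rightarrow> 'n \<Rightarrow> complex ^ 'd ^ 'd"
  assumes magic: "magic_unitary u"
  shows "trace_correlation u \<in> Q_set"
proof -
  let ?p = "trace_correlation u"
  let ?d = "real CARD('d)"
  note herm = magic_hermitian[OF magic] and idem = magic_idem[OF magic]
    and row = magic_row[OF magic]
  have p: "?p $ (l, k, i, j) = (norm (u i l ** u j k))\<^sup>2 / ?d" for l k i j
    by (simp add: trace_correlation_def trace_magic[OF magic])
  have cp: "complex_of_real (?p $ (l, k, i, j)) = trace (u i l ** u j k) / of_real ?d" for l k i j
    by (simp add: p trace_magic[OF magic])
  have total: "(\<Sum>l\<in>UNIV. \<Sum>k\<in>UNIV. ?p $ (l, k, i, j)) = 1" for i j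
  proof -
    have "complex_of_real (\<Sum>l\<in>UNIV. \<Sum>k\<in>UNIV. ?p $ (l, k, i, j)) =
        (\<Sum>l\<in>UNIV. \<Sum>k\<in>UNIV. trace (u i l ** u j k)) / of_real ?d"
      by (simp only: of_real_sum cp sum_divide_distrib)
    also have "\<dots> = 1"
      by (simp flip: trace_sum matrix_sum_ldistrib add: row trace_I)
    finally show ?thesis using of_real_eq_1_iff by blast
  qed
  have nonneg: "0 \<le> ?p $ (l, k, i, j)" for l k i j
    by (simp add: p)
  have "is_correlation ?p"
    unfolding is_correlation_def
  proof (intro conjI allI)
    fix l k i j :: 'n
    have "?p $ (l, k, i, j) \<le> (\<Sum>k\<in>UNIV. ?p $ (l, k, i, j))"
      by (rule member_le_sum) (auto simp: nonneg)
    also have "\<dots> \<le> (\<Sum>l\<in>UNIV. \<Sum>k\<in>UNIV. ?p $ (l, k, i, j))"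
      by (rule member_le_sum) (auto simp: nonneg sum_nonneg)
    finally show "?p $ (l, k, i, j) \<le> 1" by (simp add: total)
  qed (auto simp: nonneg total)
  moreover have "is_winning ?p"
    unfolding is_winning_def
  proof (intro allI impI)
    fix l k i j :: 'n assume ne: "(i = j) \<noteq> (l = k)"
    have "trace (u i l ** u j k) = 0"
    proof (cases "i = j")
      case True
      with ne show ?thesis by (simp add: trace_magic_row[OF magic])
    next
      \<comment> \<open>Here \<open>l = k\<close>, so both entries lie in one column, which is a row
        of the transposed array.\<close>
      case False
      with ne show ?thesis
        using trace_magic_row[OF magic_unitary_transpose[OF magic], of i j l] by simp
    qed
    then show "?p $ (l, k, i, j) = 0" by (simp add: trace_correlation_def)
  qed
  moreover have "\<exists>(H :: (nat \<Rightarrow> complex) cinner_space) \<psi> M N. quantum_strategy H \<psi> M N \<and>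
      (\<forall>i j l k. complex_of_real (?p $ (l, k, i, j)) = hinner H \<psi> (M i l (N j k \<psi>)))"
  proof -
    obtain \<phi> :: "complex ^ 'd ^ 'd \<Rightarrow> nat \<Rightarrow> complex" where inj: "inj \<phi>"
      using ex_inj_matrix_seq by blast
    note [simp] = hs_space_simps[OF inj] hnorm_hs_space[OF inj] finsum_hs_space[OF inj]
      inv_f_f[OF inj]
    \<comment> \<open>The squared norm of the identity is \<open>d\<close>, so \<open>c\<close>
      normalises it to the unit vector \<open>\<psi>\<close>.\<close>
    define c where "c = complex_of_real (1 / sqrt ?d)"
    define \<psi> :: "complex ^ 'd ^ 'd" where "\<psi> = map_matrix ((*) c) (mat 1)"
    define M where "M i l v = \<phi> (u i l ** inv_into UNIV \<phi> v)" for i l v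
    define N where "N j k v = \<phi> (inv_into UNIV \<phi> v ** u j k)" for j k v
    have cc: "c * cnj c = 1 / of_real ?d"
      by (simp add: c_def flip: of_real_mult)
    have herm1: "hermitian (mat 1 :: complex ^ 'd ^ 'd)"
      by (simp add: hermitian_def mat_def)
    have state: "hs_inner \<psi> (map_matrix ((*) c) A) = trace A / of_real ?d" for A
    proof -
      have "hs_inner \<psi> (map_matrix ((*) c) A) = c * cnj c * trace A"
        by (simp add: \<psi>_def hs_inner_scale_left hs_inner_scale_right hs_inner_eq_trace[OF herm1])
      then show ?thesis by (simp add: cc)
    qed
    have "hs_inner \<psi> \<psi> = 1"
      by (subst (2) \<psi>_def) (simp add: state trace_I)
    then have "(norm \<psi>)\<^sup>2 = 1"
      by (simp add: hs_inner_self flip: of_real_power)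
    then have "norm \<psi> = 1"
      using abs_square_eq_1[of "norm \<psi>"] by simp
    have "quantum_strategy (hs_space \<phi>) (\<phi> \<psi>) M N"
      unfolding quantum_strategy_def
    proof (intro conjI allI ballI)
      show "complex_hilbert_space (hs_space \<phi>)"
        using inj by (rule complex_hilbert_space_hs_space)
      show "positive_operator (hs_space \<phi>) (M i l)" for i l
        unfolding M_def
        by (rule positive_operator_hs_space[OF inj])
          (simp_all add: matrix_add_ldistrib map_matrix_mult_right hs_inner_mult_left herm
            matrix_mul_assoc idem)
      show "positive_operator (hs_space \<phi>) (N j k)" for j k
        unfolding N_def
        by (rule positive_operator_hs_space[OF inj])
          (simp_all add: matrix_add_rdistrib map_matrix_mult_left hs_inner_mult_right herm
            idem flip: matrix_mul_assoc)
      show "(\<Oplus>\<^bsub>hs_space \<phi>\<^esub>l\<in>UNIV. M i l x) = x" if "x \<in> carrier (hs_space \<phi>)" for i x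
        using that by (auto simp: M_def row simp flip: matrix_sum_rdistrib)
      show "(\<Oplus>\<^bsub>hs_space \<phi>\<^esub>k\<in>UNIV. N j k x) = x" if "x \<in> carrier (hs_space \<phi>)" for j x
        using that by (auto simp: N_def row simp flip: matrix_sum_ldistrib)
      \<comment> \<open>Left and right multiplication commute by associativity.\<close>
      show "M i l (N j k x) = N j k (M i l x)" for i l j k x
        by (simp add: M_def N_def matrix_mul_assoc)
    qed (simp_all add: \<open>norm \<psi> = 1\<close>)
    moreover have "complex_of_real (?p $ (l, k, i, j)) =
        hinner (hs_space \<phi>) (\<phi> \<psi>) (M i l (N j k (\<phi> \<psi>)))" for i j l k
    proof -
      have "u i l ** (\<psi> ** u j k) = map_matrix ((*) c) (u i l ** u j k)"
        by (simp add: \<psi>_def map_matrix_mult_right map_matrix_mult_left)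
      then show ?thesis by (simp add: M_def N_def state cp)
    qed
    ultimately show ?thesis by blast
  qed
  ultimately show ?thesis by (simp add: Q_set_def)
qed

section \<open>A classical inequality and its quantum violation\<close>

text \<open>The inequality cuts out a convex set, so it suffices to check permutations. There it
  reads \<open>a * b + a * c \<le> a + b * c\<close> with \<open>a\<close>, \<open>b\<close>,
  \<open>c\<close> the indicators of \<open>\<pi> i = l\<close>, \<open>\<pi> i' = l'\<close>,
  \<open>\<pi> i'' = l''\<close>; the term \<open>a\<close> arises as \<open>a * a\<close>.\<close>

lemma L_set_inequality:
  fixes p :: "'n::finite correlation"
  assumes "p \<in> L_set"
  shows "p $ (l, l', i, i') + p $ (l, l'', i, i'') \<le> p $ (l, l, i, i) + p $ (l', l'', i', i'')"
proof -
  let ?S = "{p. p $ (l, l', i, i') + p $ (l, l'', i, i'') \<le>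
    p $ (l, l, i, i) + p $ (l', l'', i', i'')} :: 'n correlation set"
  have "convex ?S"
  proof (rule convexI)
    fix x y and s t :: real
    assume xy: "x \<in> ?S" "y \<in> ?S" and st: "0 \<le> s" "0 \<le> t" "s + t = 1"
    have "s * (x $ (l, l', i, i') + x $ (l, l'', i, i'')) \<le>
        s * (x $ (l, l, i, i) + x $ (l', l'', i', i''))"
      and "t * (y $ (l, l', i, i') + y $ (l, l'', i, i'')) \<le>
        t * (y $ (l, l, i, i) + y $ (l', l'', i', i''))"
      using xy st by (auto intro: mult_left_mono)
    then show "s *\<^sub>R x + t *\<^sub>R y \<in> ?S"
      by (simp add: algebra_simps)
  qed
  moreover have "{perm_correlation \<pi> | \<pi>. bij \<pi>} \<subseteq> ?S"
    by (auto simp: perm_correlation_def)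
  ultimately have "L_set \<subseteq> ?S"
    unfolding L_set_def by (rule hull_minimal[rotated])
  with assms show ?thesis by blast
qed

section \<open>Projections onto lines of a real space\<close>

definition vec3 :: "real \<Rightarrow> real \<Rightarrow> real \<Rightarrow> real ^ 3" where
  "vec3 x y z = vector [x, y, z]"

text \<open>The zero vector yields the zero matrix, since \<open>x / 0 = 0\<close>.\<close>
definition line_projection :: "real ^ 'd \<Rightarrow> complex ^ 'd ^ 'd" where
  "line_projection v = (\<chi> a b. of_real (v $ a * v $ b / (v \<bullet> v)))"

lemma hermitian_line_projection: "hermitian (line_projection v)"
  by (simp add: hermitian_def line_projection_def mult.commute)

lemma trace_line_projections:
  "trace (line_projection v ** line_projection w) = of_real ((v \<bullet> w)\<^sup>2 / ((v \<bullet> v) * (w \<bullet> w)))"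
proof -
  have "trace (line_projection v ** line_projection w) =
      of_real (\<Sum>a\<in>UNIV. \<Sum>k\<in>UNIV. (v $ a * w $ a) * (v $ k * w $ k) / ((v \<bullet> v) * (w \<bullet> w)))"
    by (simp add: trace_def matrix_matrix_mult_def line_projection_def mult_ac)
  also have "\<dots> = of_real ((v \<bullet> w)\<^sup>2 / ((v \<bullet> v) * (w \<bullet> w)))"
    by (simp add: inner_vec_def power2_eq_square sum_product flip: sum_divide_distrib)
  finally show ?thesis .
qed

lemma line_projection_idem: "line_projection v ** line_projection v = line_projection v"
proof -
  have "(\<Sum>k\<in>UNIV. (v $ a * v $ k / (v \<bullet> v)) * (v $ k * v $ b / (v \<bullet> v))) =
      v $ a * v $ b / (v \<bullet> v)" for a b
  proof -
    have "(\<Sum>k\<in>UNIV. (v $ a * v $ k / (v \<bullet> v)) * (v $ k * v $ b / (v \<bullet> v))) =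
        v $ a * v $ b / (v \<bullet> v)\<^sup>2 * (\<Sum>k\<in>UNIV. v $ k * v $ k)"
      by (simp add: sum_distrib_left sum_divide_distrib power2_eq_square mult_ac)
    also have "(\<Sum>k\<in>UNIV. v $ k * v $ k) = v \<bullet> v"
      by (simp add: inner_vec_def)
    finally show ?thesis by (simp add: power2_eq_square)
  qed
  moreover have "(line_projection v ** line_projection v) $ a $ b =
      of_real (\<Sum>k\<in>UNIV. (v $ a * v $ k / (v \<bullet> v)) * (v $ k * v $ b / (v \<bullet> v)))" for a b
    by (simp add: line_projection_def matrix_matrix_mult_def)
  ultimately show ?thesis
    by (simp only: vec_eq_iff) (simp add: line_projection_def)
qed

section \<open>Arrays over five indices and the array of lines\<close>

lemma exhaust_5: "(x::5) = 0 \<or> x = 1 \<or> x = 2 \<or> x = 3 \<or> x = 4"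
proof (induct x)
  case (of_int z)
  then have "z = 0 \<or> z = 1 \<or> z = 2 \<or> z = 3 \<or> z = 4" by simp arith
  then show ?case by auto
qed

lemma UNIV_5: "(UNIV :: 5 set) = {0, 1, 2, 3, 4}"
  using exhaust_5 by auto

lemma forall_5: "(\<forall>x :: 5. P x) \<longleftrightarrow> P 0 \<and> P 1 \<and> P 2 \<and> P 3 \<and> P 4"
  by (metis exhaust_5)

lemma sum_5: "sum f (UNIV :: 5 set) = f 0 + f 1 + f 2 + f 3 + f 4"
  unfolding UNIV_5 by (simp add: ac_simps)

definition row_of5 :: "'a \<Rightarrow> 'a \<Rightarrow> 'a \<Rightarrow> 'a \<Rightarrow> 'a \<Rightarrow> 5 \<Rightarrow> 'a" where
  "row_of5 v0 v1 v2 v3 v4 i =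
     (if i = 0 then v0 else if i = 1 then v1 else if i = 2 then v2 else if i = 3 then v3 else v4)"

lemma row_of5_simps [simp]:
  "row_of5 v0 v1 v2 v3 v4 0 = v0" "row_of5 v0 v1 v2 v3 v4 1 = v1" "row_of5 v0 v1 v2 v3 v4 2 = v2"
  "row_of5 v0 v1 v2 v3 v4 3 = v3" "row_of5 v0 v1 v2 v3 v4 4 = v4"
  by (simp_all add: row_of5_def)

text \<open>
  Start with the standard basis in row \<open>0\<close> and lines \<open>b = (\<beta>, 1, 0)\<close> at \<open>(1, 2)\<close> and \<open>c = (x, y, z)\<close>
  at \<open>(3, 4)\<close>. Orthogonality in the rows and columns determines the other entries by successive
  cross products, and the only remaining condition is \<open>\<beta> * x * y + y\<^sup>2 + z\<^sup>2 = 0\<close>. Here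
  \<open>b = (2, 1, 0)\<close> and \<open>c = (1, -1, 1)\<close>.
\<close>
definition frame5 :: "5 \<Rightarrow> 5 \<Rightarrow> real ^ 3" where
  "frame5 = row_of5
     (row_of5 (vec3 1 0 0) (vec3 0 1 0) (vec3 0 0 1) 0 0)
     (row_of5 0 (vec3 0 0 1) (vec3 2 1 0) (vec3 1 (-2) 0) 0)
     (row_of5 0 0 (vec3 1 (-2) 0) (vec3 2 1 5) (vec3 2 1 (-1)))
     (row_of5 (vec3 0 1 1) 0 0 (vec3 2 1 (-1)) (vec3 1 (-1) 1))
     (row_of5 (vec3 0 (-1) 1) (vec3 1 0 0) 0 0 (vec3 0 1 1))"

text \<open>Every row and column holds three nonzero, pairwise orthogonal vectors of real 3-space,
  so their projections sum to the identity. This is confirmed entry by entry.\<close>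

lemma magic_unitary_frame5: "magic_unitary (\<lambda>i l. line_projection (frame5 i l))"
  unfolding magic_unitary_def
proof (intro conjI)
  show "\<forall>i. (\<Sum>l\<in>UNIV. line_projection (frame5 i l)) = mat 1"
    by (simp add: forall_5 sum_5 vec_eq_iff forall_3 line_projection_def mat_def frame5_def
        vec3_def inner_vec_def sum_3)
  show "\<forall>l. (\<Sum>i\<in>UNIV. line_projection (frame5 i l)) = mat 1"
    by (simp add: forall_5 sum_5 vec_eq_iff forall_3 line_projection_def mat_def frame5_def
        vec3_def inner_vec_def sum_3)
qed (simp_all add: hermitian_line_projection line_projection_idem)

theorem theorem3p19:
  shows "(\<exists>p :: 5 correlation. p \<in> Q_set \<and> p \<notin> L_set) \<and>
         complete_graph_admits_nonlocal_symmetry TYPE(5)"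
proof -
  let ?p = "trace_correlation (\<lambda>i l. line_projection (frame5 i l))"
  have "?p \<in> Q_set"
    using magic_unitary_frame5 by (rule trace_correlation_in_Q_set)
  moreover have "?p \<notin> L_set"
  proof
    assume "?p \<in> L_set"
    \<comment> \<open>The chosen cells hold \<open>a = (1, 0, 0)\<close>,
      \<open>b = (2, 1, 0)\<close> and \<open>c = (1, -1, 1)\<close>. Up to the common factor 1/3,
      the inequality would say \<open>4/5 + 1/3 \<le> 1 + 1/15\<close>, that is
      \<open>17/15 \<le> 16/15\<close>.\<close>
    from L_set_inequality[OF this, of 0 2 0 1 4 3] show False
      by (simp add: trace_correlation_def trace_line_projections frame5_def vec3_def
          inner_vec_def sum_3)
  qed
  ultimately show ?thesis
    unfolding complete_graph_admits_nonlocal_symmetry_def by blast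
qed

end
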